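(* Let $b$ be a nonzero integer such that the quadratic form $p^2+bq^2$ is irreducible over $\mathbb{Q}$ (i.e. $-b$ is not a square in $\mathbb{Q}$). Let $p_0,q_0\in\mathbb{Q}$, not both zero, and put $m=p_0^2+bq_0^2$. Let $c,d,e\in\mathbb{Q}$ with $ce\neq 0$ be such that the quartic polynomial $m^2X^4+c(dX+e)^2$ has no repeated roots. Let $\mathcal{V}$ be the surface $$\mathcal{V}:\; (p^2+bq^2)^2=m^2X^4+c(dX+e)^2$$ in the variables $(p,q,X)$, and let $\mathcal{C}'$ be the quartic curve $$\mathcal{C}':\; w^2=-b\,(2b^2U^4-bcd^2U^2-2ce^2m^2)$$ in the variables $(U,w)$. If $\mathcal{C}'(\mathbb{Q})$ is infinite, then $\mathcal{V}(\mathbb{Q})$ is infinite, in the sense that the set of $X$-coordinates of points $(p,q,X)\in\mathcal{V}(\mathbb{Q})$ is infinite.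
   Context: Here $\mathcal{V}(\mathbb{Q})$ and $\mathcal{C}'(\mathbb{Q})$ denote the sets of rational solutions $(p,q,X)\in\mathbb{Q}^3$, respectively $(U,w)\in\mathbb{Q}^2$, of the displayed affine equations. Convention: "$\mathcal{V}(\mathbb{Q})$ is infinite" means that $\pi_X(\mathcal{V}(\mathbb{Q}))$ is infinite, where $\pi_X:\mathcal{V}(\mathbb{Q})\to\mathbb{Q}$ is the projection $(p,q,X)\mapsto X$. *)

theory Defs
  imports Complex_Main "HOL-Computational_Algebra.Computational_Algebra"
begin

(* The form p^2 + b q^2 as an element of Q[q][p]: the outer polynomial variable is p,
   the inner one is q. *)
definition norm_form :: "int \<Rightarrow> rat poly poly" where
  "norm_form b = [:[:0, 0, of_int b:], 0, 1:]"

lemma poly_norm_form: "poly (poly (norm_form b) [:p:]) q = p\<^sup>2 + of_int b * q\<^sup>2"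
  by (simp add: norm_form_def power2_eq_square algebra_simps)

definition quartic :: "rat \<Rightarrow> rat \<Rightarrow> rat \<Rightarrow> rat \<Rightarrow> rat poly" where
  "quartic m c d e = monom (m\<^sup>2) 4 + smult c ([:e, d:]\<^sup>2)"

lemma poly_quartic: "poly (quartic m c d e) X = m\<^sup>2 * X ^ 4 + c * (d * X + e)\<^sup>2"
  by (simp add: quartic_def poly_monom algebra_simps)

(* Repeated roots are understood over an algebraically closed field: rsquarefree only
   speaks about roots in the coefficient field, hence the passage to complex coefficients. *)
definition no_repeated_roots :: "rat poly \<Rightarrow> bool" where
  "no_repeated_roots f \<longleftrightarrow> rsquarefree (map_poly (of_rat :: rat \<Rightarrow> complex) f)"

definition surface_V :: "int \<Rightarrow> rat \<Rightarrow> rat \<Rightarrow> rat \<Rightarrow> rat \<Rightarrow> (rat \<times> rat \<times> rat) set" where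
  "surface_V b m c d e =
     {(p, q, X). (p\<^sup>2 + of_int b * q\<^sup>2)\<^sup>2 = m\<^sup>2 * X ^ 4 + c * (d * X + e)\<^sup>2}"

definition curve_C' :: "int \<Rightarrow> rat \<Rightarrow> rat \<Rightarrow> rat \<Rightarrow> rat \<Rightarrow> (rat \<times> rat) set" where
  "curve_C' b m c d e =
     {(U, w). w\<^sup>2 = - of_int b * (2 * (of_int b)\<^sup>2 * U ^ 4
                      - of_int b * c * d\<^sup>2 * U\<^sup>2 - 2 * c * e\<^sup>2 * m\<^sup>2)}"

definition proj_X :: "rat \<times> rat \<times> rat \<Rightarrow> rat" where
  "proj_X = (\<lambda>(p, q, X). X)"

lemma irreducible_norm_form_iff:
  "irreducible (norm_form b) \<longleftrightarrow> \<not> (\<exists>r::rat. r\<^sup>2 = - of_int b)"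
proof
  assume irr: "irreducible (norm_form b)"
  show "\<not> (\<exists>r::rat. r\<^sup>2 = - of_int b)"
  proof
    assume "\<exists>r::rat. r\<^sup>2 = - of_int b"
    then obtain r :: rat where r: "r\<^sup>2 = - of_int b" by blast
    have "norm_form b = [:[:0, r:], 1:] * [:[:0, - r:], 1:]"
      using r by (simp add: norm_form_def power2_eq_square)
    then have "is_unit [:[:0, r:], 1:] \<or> is_unit [:[:0, - r:], 1::rat poly:]"
      using irr irreducibleD by blast
    then show False by (auto simp: is_unit_poly_iff)
  qed
next
  assume nsq: "\<not> (\<exists>r::rat. r\<^sup>2 = - of_int b)"
  show "irreducible (norm_form b)"
  proof (rule irreducibleI)
    show "norm_form b \<noteq> 0" by (simp add: norm_form_def)
    show "\<not> is_unit (norm_form b)" by (auto simp: norm_form_def is_unit_poly_iff)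
  next
    fix f g assume fg: "norm_form b = f * g"
    have fg0: "f \<noteq> 0" "g \<noteq> 0" using fg by (auto simp: norm_form_def)
    have deg: "degree f + degree g = 2"
      by (simp add: degree_mult_eq[OF fg0, symmetric] fg[symmetric]) (simp add: norm_form_def)
    have "lead_coeff f * lead_coeff g = lead_coeff (norm_form b)"
      by (simp add: fg lead_coeff_mult)
    then have lc: "lead_coeff f * lead_coeff g = 1" by (simp add: norm_form_def)
    show "is_unit f \<or> is_unit g"
    proof (rule ccontr)
      assume nu: "\<not> (is_unit f \<or> is_unit g)"
      have "degree f \<noteq> 0"
      proof
        assume "degree f = 0"
        then obtain a where a: "f = [:a:]" by (auto elim: degree_eq_zeroE)
        with lc have "a * lead_coeff g = 1" by simp
        then have "is_unit a" by (metis dvd_triv_left)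
        then have "is_unit f" by (simp add: a is_unit_const_poly_iff)
        with nu show False by simp
      qed
      moreover have "degree g \<noteq> 0"
      proof
        assume "degree g = 0"
        then obtain a where a: "g = [:a:]" by (auto elim: degree_eq_zeroE)
        with lc have "lead_coeff f * a = 1" by simp
        then have "is_unit a" by (metis dvd_triv_right)
        then have "is_unit g" by (simp add: a is_unit_const_poly_iff)
        with nu show False by simp
      qed
      ultimately have d1: "degree f = 1" "degree g = 1" using deg by auto
      obtain s u where f: "f = [:s, u:]" using d1(1) by (metis degree1_coeffs)
      obtain t v where g: "g = [:t, v:]" using d1(2) by (metis degree1_coeffs)
      have eqs: "s * t = [:0, 0, of_int b:]" "s * v + u * t = 0" "u * v = 1"
        using fg by (auto simp: norm_form_def f g algebra_simps)
      have "(s * v)\<^sup>2 = - (s * v) * (u * t)" using eqs(2)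
        by (metis add_eq_0_iff2 minus_mult_right mult_minus_left power2_eq_square)
      also have "\<dots> = - ((s * t) * (u * v))" by (simp add: algebra_simps)
      finally have sq: "(s * v)\<^sup>2 = [:0, 0, - of_int b:]" using eqs by simp
      have "(poly (s * v) 1)\<^sup>2 = poly [:0, 0, - of_int b:] 1" by (simp only: sq[symmetric] poly_power)
      then show False using nsq by simp
    qed
  qed
qed

end

theory Submission
  imports Defs
begin

text \<open>
  Write $\theta = \sqrt{-b}$, so that $p^2 + b q^2$ is the norm of $p + q\theta$ and $m$ is the norm
  of $p_0 + q_0\theta$. Points on the surface are sought among the multiples
  $p + q\theta = (p_0 + q_0\theta)(X + t\theta)$, whose norm is $m(X^2 + bt^2)$. For these the terms
  $m^2X^4$ on the two sides of the equation of the surface cancel, and with $U = mt$ what is left is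
  \[ 2bU^2X^2 + b^2U^4/m^2 = c(dX+e)^2. \]
  This equation is quadratic in $X$, with leading coefficient $2bU^2 - cd^2$, and a quarter
  of its discriminant is $(U/m)^2$ times the right-hand side of the equation of the
  quartic curve. A rational point $(U,w)$ of the curve therefore gives a rational root $X$, namely
  $(cde + (U/m)w)/(2bU^2 - cd^2)$, and so a point on the surface; only the at most two values of $U$
  that annihilate the denominator must be avoided.

  Infinitely many $X$ arise, because the displayed equation is also a quartic in $U$ with the nonzero
  leading coefficient $b^2/m^2$: one $X$ belongs to at most four values of $U$, and one $U$
  to at most two points of the curve. Irreducibility of the form enters through $m \<noteq> 0$.
\<close>

lemma finite_roots_biquadratic:
  fixes \<alpha> \<beta> \<gamma> :: "'a :: {comm_ring_1, ring_no_zero_divisors}"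
  assumes "\<alpha> \<noteq> 0 \<or> \<beta> \<noteq> 0"
  shows "finite {x. \<alpha> * x ^ 4 + \<beta> * x\<^sup>2 + \<gamma> = 0}"
proof -
  have "[:\<gamma>, 0, \<beta>, 0, \<alpha>:] \<noteq> 0"
    using assms by auto
  then have "finite {x. poly [:\<gamma>, 0, \<beta>, 0, \<alpha>:] x = 0}"
    by (rule poly_roots_finite)
  moreover have "poly [:\<gamma>, 0, \<beta>, 0, \<alpha>:] x = \<alpha> * x ^ 4 + \<beta> * x\<^sup>2 + \<gamma>" for x
    by (simp add: algebra_simps power2_eq_square power4_eq_xxxx)
  ultimately show ?thesis
    by (simp only:)
qed

lemma norm_form_anisotropic:
  fixes p q :: rat
  assumes "irreducible (norm_form b)" and "p\<^sup>2 + of_int b * q\<^sup>2 = 0"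
  shows "p = 0 \<and> q = 0"
proof -
  have "q = 0"
  proof (rule ccontr)
    assume "q \<noteq> 0"
    then have "(p / q)\<^sup>2 = - of_int b"
      using assms(2) by (simp add: power_divide divide_eq_eq)
    then show False
      using assms(1) unfolding irreducible_norm_form_iff by blast
  qed
  then show ?thesis
    using assms(2) by simp
qed

lemma finite_curve_C'_over_finite:
  assumes "finite F"
  shows "finite {P \<in> curve_C' b m c d e. fst P \<in> F}"
proof -
  define r where "r U = - of_int b * (2 * (of_int b)\<^sup>2 * U ^ 4
                      - of_int b * c * d\<^sup>2 * U\<^sup>2 - 2 * c * e\<^sup>2 * m\<^sup>2)" for U
  have "finite {w. w\<^sup>2 = r U}" for U
    using finite_roots_biquadratic[of 0 1 "- r U"] by simp
  then have "finite (SIGMA U:F. {w. w\<^sup>2 = r U})"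
    using assms by blast
  then show ?thesis
    by (rule rev_finite_subset) (auto simp: curve_C'_def r_def)
qed

text \<open>
  The equation that remains for $U = mt$ after the substitution
  $p + q\theta = (p_0 + q_0\theta)(X + t\theta)$.
\<close>

definition slice :: "int \<Rightarrow> rat \<Rightarrow> rat \<Rightarrow> rat \<Rightarrow> rat \<Rightarrow> rat \<Rightarrow> rat \<Rightarrow> bool" where
  "slice b m c d e U X \<longleftrightarrow>
     2 * of_int b * U\<^sup>2 * X\<^sup>2 + (of_int b)\<^sup>2 * U ^ 4 / m\<^sup>2 = c * (d * X + e)\<^sup>2"

text \<open>
  Multiplicativity of the norm: the two expressions squared below are the coordinates of
  $(p_0 + q_0\theta)(X + (U/m)\theta)$.
\<close>

lemma slice_imp_proj_X_surface_V:
  assumes "m = p0\<^sup>2 + of_int b * q0\<^sup>2" and "m \<noteq> 0" and "slice b m c d e U X"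
  shows "X \<in> proj_X ` surface_V b m c d e"
proof -
  define t where "t = U / m"
  have U: "U = m * t"
    using assms(2) by (simp add: t_def)
  define p where "p = p0 * X - of_int b * q0 * t"
  define q where "q = p0 * t + q0 * X"
  have "p\<^sup>2 + of_int b * q\<^sup>2 = (p0\<^sup>2 + of_int b * q0\<^sup>2) * (X\<^sup>2 + of_int b * t\<^sup>2)"
    unfolding p_def q_def by algebra
  then have "(p\<^sup>2 + of_int b * q\<^sup>2)\<^sup>2 = (m * (X\<^sup>2 + of_int b * t\<^sup>2))\<^sup>2"
    by (simp add: assms(1))
  also have "\<dots> = m\<^sup>2 * X ^ 4 + (2 * of_int b * U\<^sup>2 * X\<^sup>2 + (of_int b)\<^sup>2 * (m\<^sup>2 * t ^ 4))"
    unfolding U by algebra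
  also have "m\<^sup>2 * t ^ 4 = U ^ 4 / m\<^sup>2"
    using assms(2) unfolding t_def by (simp add: field_simps power2_eq_square power4_eq_xxxx)
  also have "2 * of_int b * U\<^sup>2 * X\<^sup>2 + (of_int b)\<^sup>2 * (U ^ 4 / m\<^sup>2) = c * (d * X + e)\<^sup>2"
    using assms(3) by (simp add: slice_def)
  finally have "(p, q, X) \<in> surface_V b m c d e"
    by (simp add: surface_V_def)
  then show ?thesis
    by (force simp: proj_X_def)
qed

text \<open>
  The quadratic formula for \<open>slice\<close> as an equation in $X$. The point lies on the curve exactly
  so that $(U/m)w$ is a square root of a quarter of the discriminant.
\<close>

lemma slice_of_curve_C':
  assumes "(U, w) \<in> curve_C' b m c d e" and "m \<noteq> 0"
    and nz: "2 * of_int b * U\<^sup>2 - c * d\<^sup>2 \<noteq> 0"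
  shows "slice b m c d e U ((c * d * e + U / m * w) / (2 * of_int b * U\<^sup>2 - c * d\<^sup>2))"
proof -
  define A where "A = 2 * of_int b * U\<^sup>2 - c * d\<^sup>2"
  define t where "t = U / m"
  define X where "X = (c * d * e + t * w) / A"
  have "A \<noteq> 0"
    using nz by (simp add: A_def)
  have U: "U = m * t"
    using assms(2) by (simp add: t_def)
  have w: "w\<^sup>2 = - of_int b * (2 * (of_int b)\<^sup>2 * U ^ 4
             - of_int b * c * d\<^sup>2 * U\<^sup>2 - 2 * c * e\<^sup>2 * m\<^sup>2)"
    using assms(1) by (simp add: curve_C'_def)
  define B where "B = (of_int b)\<^sup>2 * m\<^sup>2 * t ^ 4 - c * e\<^sup>2"
  have "(t * w)\<^sup>2 = (c * d * e)\<^sup>2 - A * B"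
    using w unfolding A_def B_def U by algebra
  moreover have "A * X - c * d * e = t * w"
    using \<open>A \<noteq> 0\<close> by (simp add: X_def)
  ultimately have "A * (A * X\<^sup>2 - 2 * c * d * e * X + B) = 0"
    by algebra
  then have root: "A * X\<^sup>2 - 2 * c * d * e * X + B = 0"
    using \<open>A \<noteq> 0\<close> by simp
  have "2 * of_int b * U\<^sup>2 * X\<^sup>2 + (of_int b)\<^sup>2 * (m\<^sup>2 * t ^ 4) = c * (d * X + e)\<^sup>2"
    using root unfolding A_def B_def by algebra
  moreover have "m\<^sup>2 * t ^ 4 = U ^ 4 / m\<^sup>2"
    using assms(2) unfolding t_def by (simp add: field_simps power2_eq_square power4_eq_xxxx)
  ultimately have "slice b m c d e U X"
    by (simp add: slice_def)
  then show ?thesis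
    by (simp add: X_def A_def t_def)
qed

text \<open>For fixed $X$ the equation is a quartic in $U$ with leading coefficient $b^2/m^2$.\<close>

lemma finite_slice:
  assumes "b \<noteq> 0" and "m \<noteq> 0"
  shows "finite {U. slice b m c d e U X}"
proof -
  have "{U. slice b m c d e U X} = {U. ((of_int b)\<^sup>2 / m\<^sup>2) * U ^ 4
          + (2 * of_int b * X\<^sup>2) * U\<^sup>2 + - (c * (d * X + e)\<^sup>2) = 0}"
    by (auto simp: slice_def algebra_simps)
  also have "finite \<dots>"
    by (rule finite_roots_biquadratic) (use assms in simp)
  finally show ?thesis .
qed

theorem theorem2p2:
  fixes b :: int and p0 q0 m c d e :: rat
  assumes "b \<noteq> 0"
    and "irreducible (norm_form b)"
    and "\<not> (p0 = 0 \<and> q0 = 0)"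
    and "m = p0\<^sup>2 + of_int b * q0\<^sup>2"
    and "c * e \<noteq> 0"
    and "no_repeated_roots (quartic m c d e)"
    and "infinite (curve_C' b m c d e)"
  shows "infinite (proj_X ` surface_V b m c d e)"
proof
  assume fin: "finite (proj_X ` surface_V b m c d e)"
  let ?C = "curve_C' b m c d e"
  have "m \<noteq> 0"
    using norm_form_anisotropic[OF assms(2), of p0 q0] assms(3,4) by auto
  define Z :: "rat set" where "Z = {U. 2 * of_int b * U\<^sup>2 - c * d\<^sup>2 = 0}"
  define F where "F = Z \<union> (\<Union>X\<in>proj_X ` surface_V b m c d e. {U. slice b m c d e U X})"
  have "finite Z"
    using finite_roots_biquadratic[of 0 "2 * of_int b" "- (c * d\<^sup>2)"] assms(1)
    by (simp add: Z_def)
  then have "finite F"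
    unfolding F_def using fin finite_slice[OF assms(1) \<open>m \<noteq> 0\<close>] by blast
  have "fst P \<in> F" if "P \<in> ?C" for P
  proof (cases "fst P \<in> Z")
    case True
    then show ?thesis by (simp add: F_def)
  next
    case False
    have "(fst P, snd P) \<in> ?C"
      using that by simp
    then obtain X where "slice b m c d e (fst P) X"
      using slice_of_curve_C'[OF _ \<open>m \<noteq> 0\<close>] False unfolding Z_def by blast
    moreover from this have "X \<in> proj_X ` surface_V b m c d e"
      by (rule slice_imp_proj_X_surface_V[OF assms(4) \<open>m \<noteq> 0\<close>])
    ultimately show ?thesis
      unfolding F_def by blast
  qed
  then have "?C = {P \<in> ?C. fst P \<in> F}"
    by blast
  with finite_curve_C'_over_finite[OF \<open>finite F\<close>] assms(7) show False
    by metis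
qed

end
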